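(* Consider the setting, notation and standing assumptions given in the context. Let $$\alpha_{1} = 1 + 2\lvert K^{\star\mathrm{T}}\bar{B}^\mathrm{T}P^{\star}\bar{B}K^{\star}\rvert^{2} + 2\lvert\bar{A}^\mathrm{T}P^{\star}\bar{A}\rvert^{2},\qquad \alpha_{2} = 2 + 4 \lvert K^{\star\mathrm{T}}\bar{B}^\mathrm{T}P^{\star}\bar{B}K^{\star}\rvert^{2} + 4 \lvert\tilde{D}^\mathrm{T}P^{\star}\tilde{D}\rvert^{2},$$ $$\omega_{1} = \frac{\lambda_{m}(Q)}{\lambda_{M}(P^{\star})},\qquad \omega_{2} = \frac{\alpha_{1}+4\alpha_{2}}{\lambda_{m}(P^{\star})}.$$ The error system $$\tilde{\zeta}_{k+1} = (\bar{A}-\bar{B}K^{\star})\tilde{\zeta}_{k} - \bar{B}K^{\star}\bar{\epsilon}_{k} + \begin{bmatrix}0\\ \mathcal{G}_2\bar C\bar\epsilon_k\end{bmatrix},\qquad e_k=\bar C\tilde\zeta_k,$$ with $\tilde\zeta_k=\zeta_k-\Xi w_k$ and $\bar\epsilon_k=\zeta_{k_{m(k)}}-\zeta_k=\tilde\zeta_{k_{m(k)}}-\tilde\zeta_k$, is globally asymptotically stable if the DoS duration parameter $T$ satisfies $$T > 1 + \frac{\log(1+\omega_{2})}{-\log(1-\omega_{1})} =: T^{\star}.$$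
   Context: Notation: $\mathbb{Z}_+$ is the set of non-negative integers; $|\cdot|$ is the Euclidean norm of a vector, the induced matrix norm of a matrix, and the Lebesgue measure of a set; $\lambda_m(\cdot),\lambda_M(\cdot)$ are the minimum and maximum eigenvalues of a real symmetric matrix; $\sigma(\cdot)$ is the spectrum. System: for $k\in\mathbb{Z}_+$, $x_{k+1}=Ax_k+Bu_k+Dw_k$, $w_{k+1}=Ew_k$, $e_k=Cx_k+Fw_k$, with constant matrices $A\in\mathbb{R}^{n\times n}$, $B\in\mathbb{R}^{n}$, $C\in\mathbb{R}^{1\times n}$, $D\in\mathbb{R}^{n\times q}$, $E\in\mathbb{R}^{q\times q}$, $F\in\mathbb{R}^{1\times q}$, state $x_k$, exosystem state $w_k$, scalar input $u_k$ and scalar output $e_k$. Standing assumptions: $(A,B)$ is stabilizable; the eigenvalues of $E$ are simple on the unit circle; $\mathrm{rank}\begin{bmatrix}A-\lambda I & B\\ C&0\end{bmatrix}=n+1$ for all $\lambda\in\sigma(E)$; $\mathcal{G}_2\in\mathbb{R}^q$ is such that $(E,\mathcal{G}_2)$ is controllable. Put $$\bar A=\begin{bmatrix}A&0\\ \mathcal{G}_2C&E\end{bmatrix},\quad \bar B=\begin{bmatrix}B\\0\end{bmatrix},\quad \bar C=[\,C\ \ 0\,],\quad \bar D=\begin{bmatrix}D\\ \mathcal{G}_2F\end{bmatrix},\quad \tilde D=\begin{bmatrix}0\\ \mathcal{G}_2\bar C\end{bmatrix}.$$ Let $Q=Q^{\mathrm T}\succ0$, let $P^\star=P^{\star\mathrm{T}}\succ0$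 solve the discrete-time algebraic Riccati equation $$\bar{A}^\mathrm{T}P^{\star}\bar{A}-P^{\star}+Q-\bar{A}^\mathrm{T}P^{\star}\bar{B}(1+\bar{B}^\mathrm{T}P^{\star}\bar{B})^{-1}\bar{B}^\mathrm{T}P^{\star}\bar{A} = 0,$$ and let $K^{\star} = (1+\bar{B}^\mathrm{T}P^{\star}\bar{B})^{-1}\bar{B}^\mathrm{T}P^{\star}\bar{A}=[K_x^\star\ \ K_z^\star]$. Let $X,Z$ be the unique solutions of $XE=(A-BK_x^\star)X-BK_z^\star Z+D$, $ZE=EZ+\mathcal{G}_2(CX+F)$, $0=CX+F$, and put $\Xi=[X^{\mathrm T}\ \ Z^{\mathrm T}]^{\mathrm T}$. DoS attacks (which simultaneously affect the measurement and control channels): $\{h_m\}_{m\in\mathbb{Z}_+}$, $h_0\ge0$, is the sequence of off/on transitions of the DoS attack, and the $m$-th attack interval, of length $\tau_m$, is $\mathcal{J}_m=[h_m,h_m+\tau_m)$. For each interval $[k_1,k_2]$ set $\Lambda_D(k_1,k_2)=\bigcup_{m\in\mathbb{Z}_+}\mathcal{J}_m\cap[k_1,k_2]$ (communication denied) and $\Lambda_N(k_1,k_2)=[k_1,k_2]\setminus\Lambda_D(k_1,k_2)$ (communication allowed). DoS frequency assumption: there exist $\eta>1$, $\tau_D>0$ such that for all $k_2>k_1\ge0$ the number $n(k_1,k_2)$ of DoS off/on transitions on $[k_1,k_2]$ satisfies $n(k_1,k_2)\le\eta+\frac{k_2-k_1}{\tau_D}$. DoS duration assumption: there exist $T>1$,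 $\kappa>0$ such that for all $k_2>k_1\ge0$, $|\Lambda_D(k_1,k_2)|\le\kappa+\frac{k_2-k_1}{T}$. Closed loop under DoS: with $\zeta_k=[x_k^{\mathrm T}\ \ z_k^{\mathrm T}]^{\mathrm T}$, the control input and internal model are $u_k=-K^\star\zeta_{k_{m(k)}}$ and $z_{k+1}=Ez_k+\mathcal{G}_2e_{k_{m(k)}}$, where $k_{m(k)}$ is the most recent time instant at which the updated information is received. With $\bar\epsilon_k=\zeta_{k_{m(k)}}-\zeta_k$ and $\underline\epsilon_k=e_{k_{m(k)}}-e_k$ the closed loop is $$\zeta_{k+1}=(\bar A-\bar BK^\star)\zeta_k-\bar BK^\star\bar\epsilon_k+\bar Dw_k+\begin{bmatrix}0\\ \mathcal{G}_2\underline\epsilon_k\end{bmatrix},$$ and with $\tilde\zeta_k=\zeta_k-\Xi w_k$, writing $\bar\epsilon_k=\zeta_{k_{m(k)}}-\zeta_k=\tilde\zeta_{k_{m(k)}}-\tilde\zeta_k$ and $\underline\epsilon_k=\bar C\bar\epsilon_k$, one is led to the error system in the claim. *)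

theory Defs
  imports "HOL-Analysis.Analysis" "HOL-Computational_Algebra.Polynomial"
begin

text \<open>
  Matrices with \<open>r\<close> rows and \<open>c\<close> columns have type \<open>real ^ 'c ^ 'r\<close>. Column vectors that enter
  matrix formulas (the input and internal-model vectors) are matrices of type \<open>real ^ 1 ^ 'r\<close>, row
  vectors are of type \<open>real ^ 'c ^ 1\<close>, and scalar signals are of type \<open>real ^ 1\<close>.
\<close>

section \<open>Block matrices\<close>

definition stack :: "'a ^ 'n ^ 'm \<Rightarrow> 'a ^ 'n ^ 'k \<Rightarrow> 'a ^ 'n ^ ('m + 'k)" where
  "stack M N = (\<chi> i. case i of Inl a \<Rightarrow> M $ a | Inr b \<Rightarrow> N $ b)"

definition vstack :: "'a ^ 'm \<Rightarrow> 'a ^ 'k \<Rightarrow> 'a ^ ('m + 'k)" where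
  "vstack x y = (\<chi> i. case i of Inl a \<Rightarrow> x $ a | Inr b \<Rightarrow> y $ b)"

definition beside :: "'a ^ 'm ^ 'r \<Rightarrow> 'a ^ 'k ^ 'r \<Rightarrow> 'a ^ ('m + 'k) ^ 'r" where
  "beside M N = (\<chi> i. vstack (M $ i) (N $ i))"

definition block ::
  "'a ^ 'm ^ 'r \<Rightarrow> 'a ^ 'k ^ 'r \<Rightarrow> 'a ^ 'm ^ 's \<Rightarrow> 'a ^ 'k ^ 's \<Rightarrow> 'a ^ ('m + 'k) ^ ('r + 's)" where
  "block M11 M12 M21 M22 = stack (beside M11 M12) (beside M21 M22)"

section \<open>Spectra and norms\<close>

definition eigenvalues :: "'a::field ^ 'n ^ 'n \<Rightarrow> 'a set" where
  "eigenvalues M = {l. \<exists>v. v \<noteq> 0 \<and> M *v v = l *s v}"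

definition cmat :: "real ^ 'n ^ 'm \<Rightarrow> complex ^ 'n ^ 'm" where
  "cmat M = (\<chi> i j. complex_of_real (M $ i $ j))"

definition spec :: "real ^ 'n ^ 'n \<Rightarrow> complex set" where
  "spec M = eigenvalues (cmat M)"

definition charpoly :: "'a::comm_ring_1 ^ 'n ^ 'n \<Rightarrow> 'a poly" where
  "charpoly M = det (\<chi> i j. (if i = j then [:0, 1:] else 0) - [:M $ i $ j:])"

definition simple_on_unit_circle :: "real ^ 'n ^ 'n \<Rightarrow> bool" where
  "simple_on_unit_circle M \<longleftrightarrow>
     (\<forall>l \<in> spec M. cmod l = 1 \<and> order l (charpoly (cmat M)) = 1)"

text \<open>For symmetric matrices, whose eigenvalues are real.\<close>

definition lambda_min :: "real ^ 'n ^ 'n \<Rightarrow> real" where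
  "lambda_min M = Min (eigenvalues M)"

definition lambda_max :: "real ^ 'n ^ 'n \<Rightarrow> real" where
  "lambda_max M = Max (eigenvalues M)"

definition mnorm :: "real ^ 'n ^ 'm \<Rightarrow> real" where
  "mnorm M = onorm (\<lambda>v. M *v v)"

definition sym_posdef :: "real ^ 'n ^ 'n \<Rightarrow> bool" where
  "sym_posdef M \<longleftrightarrow> transpose M = M \<and> (\<forall>v. v \<noteq> 0 \<longrightarrow> v \<bullet> (M *v v) > 0)"

section \<open>Stabilizability and controllability\<close>

definition schur_stable :: "real ^ 'n ^ 'n \<Rightarrow> bool" where
  "schur_stable M \<longleftrightarrow> (\<forall>l \<in> spec M. cmod l < 1)"

definition stabilizable :: "real ^ 'n ^ 'n \<Rightarrow> real ^ 'p ^ 'n \<Rightarrow> bool" where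
  "stabilizable A B \<longleftrightarrow> (\<exists>K :: real ^ 'n ^ 'p. schur_stable (A - B ** K))"

text \<open>
  Kalman's condition: the columns of \<open>B\<close>, \<open>A B\<close>, \<dots>, \<open>A\<^sup>n\<^sup>-\<^sup>1 B\<close> span an \<open>n\<close>-dimensional space.
  (The operator \<open>^\<close> on matrices is componentwise, whence the explicit iteration.)
\<close>

definition controllable :: "real ^ 'n ^ 'n \<Rightarrow> real ^ 'p ^ 'n \<Rightarrow> bool" where
  "controllable A B \<longleftrightarrow>
     dim (\<Union>i < CARD('n). columns (((\<lambda>M. A ** M) ^^ i) B)) = CARD('n)"

section \<open>DoS attacks\<close>

text \<open>
  Attacks start and end at sampling instants: \<open>h m\<close> is the \<open>m\<close>-th off/on transition and \<open>\<tau> m\<close> the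
  length of the \<open>m\<close>-th attack interval. Intervals are real intervals, so that their Lebesgue measure
  is meaningful.
\<close>

definition attack_interval :: "(nat \<Rightarrow> nat) \<Rightarrow> (nat \<Rightarrow> nat) \<Rightarrow> nat \<Rightarrow> real set" where
  "attack_interval h \<tau> m = {real (h m) ..< real (h m) + real (\<tau> m)}"

definition denied :: "(nat \<Rightarrow> nat) \<Rightarrow> (nat \<Rightarrow> nat) \<Rightarrow> real \<Rightarrow> real \<Rightarrow> real set" where
  "denied h \<tau> k1 k2 = (\<Union>m. attack_interval h \<tau> m) \<inter> {k1..k2}"

definition allowed :: "(nat \<Rightarrow> nat) \<Rightarrow> (nat \<Rightarrow> nat) \<Rightarrow> real \<Rightarrow> real \<Rightarrow> real set" where
  "allowed h \<tau> k1 k2 = {k1..k2} - denied h \<tau> k1 k2"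

definition transitions :: "(nat \<Rightarrow> nat) \<Rightarrow> nat \<Rightarrow> nat \<Rightarrow> nat" where
  "transitions h k1 k2 = card {m. k1 \<le> h m \<and> h m \<le> k2}"

definition dos_frequency :: "(nat \<Rightarrow> nat) \<Rightarrow> real \<Rightarrow> real \<Rightarrow> bool" where
  "dos_frequency h \<eta> \<tau>D \<longleftrightarrow> \<eta> > 1 \<and> \<tau>D > 0 \<and>
     (\<forall>k1 k2. k1 < k2 \<longrightarrow> real (transitions h k1 k2) \<le> \<eta> + (real k2 - real k1) / \<tau>D)"

definition dos_duration :: "(nat \<Rightarrow> nat) \<Rightarrow> (nat \<Rightarrow> nat) \<Rightarrow> real \<Rightarrow> real \<Rightarrow> bool" where
  "dos_duration h \<tau> T \<kappa> \<longleftrightarrow> T > 1 \<and> \<kappa> > 0 \<and>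
     (\<forall>k1 k2 :: nat. k1 < k2 \<longrightarrow>
        measure lborel (denied h \<tau> (real k1) (real k2)) \<le> \<kappa> + (real k2 - real k1) / T)"

text \<open>
  The most recent instant up to \<open>k\<close> at which information was received. The initial data are taken
  to be known, so the value is \<open>0\<close> as long as nothing has been received.
\<close>

definition last_update :: "(nat \<Rightarrow> nat) \<Rightarrow> (nat \<Rightarrow> nat) \<Rightarrow> nat \<Rightarrow> nat" where
  "last_update h \<tau> k = Max (insert 0 {j. real j \<in> allowed h \<tau> 0 (real k)})"

section \<open>Closed loop and error system\<close>

text \<open>
  In the following, \<open>r k\<close> is the index of the sample that is available at time \<open>k\<close>. The two
  expressions for \<open>\<epsilon> k\<close> agree only if \<open>\<Xi> *v w (r k) = \<Xi> *v w k\<close>; both are part of the error system.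
\<close>

definition closed_loop ::
  "real ^ 'n ^ 'n \<Rightarrow> real ^ 1 ^ 'n \<Rightarrow> real ^ 'n ^ 1 \<Rightarrow> real ^ 'q ^ 'n \<Rightarrow> real ^ 'q ^ 'q \<Rightarrow>
   real ^ 'q ^ 1 \<Rightarrow> real ^ 1 ^ 'q \<Rightarrow> real ^ ('n + 'q) ^ 1 \<Rightarrow> (nat \<Rightarrow> nat) \<Rightarrow>
   (nat \<Rightarrow> real ^ 'n) \<Rightarrow> (nat \<Rightarrow> real ^ 'q) \<Rightarrow> (nat \<Rightarrow> real ^ 'q) \<Rightarrow> (nat \<Rightarrow> real ^ 1) \<Rightarrow>
   (nat \<Rightarrow> real ^ 1) \<Rightarrow> bool" where
  "closed_loop A B C D E F G2 K r x z w u e \<longleftrightarrow>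
     (\<forall>k. x (Suc k) = A *v x k + B *v u k + D *v w k) \<and>
     (\<forall>k. w (Suc k) = E *v w k) \<and>
     (\<forall>k. e k = C *v x k + F *v w k) \<and>
     (\<forall>k. u k = - (K *v vstack (x (r k)) (z (r k)))) \<and>
     (\<forall>k. z (Suc k) = E *v z k + G2 *v e (r k))"

definition error_trajectory ::
  "real ^ 'n ^ 'n \<Rightarrow> real ^ 1 ^ 'n \<Rightarrow> real ^ 'n ^ 1 \<Rightarrow> real ^ 'q ^ 'n \<Rightarrow> real ^ 'q ^ 'q \<Rightarrow>
   real ^ 'q ^ 1 \<Rightarrow> real ^ 1 ^ 'q \<Rightarrow> real ^ ('n + 'q) ^ 1 \<Rightarrow> real ^ 'q ^ ('n + 'q) \<Rightarrow>
   (nat \<Rightarrow> nat) \<Rightarrow> (nat \<Rightarrow> real ^ ('n + 'q)) \<Rightarrow> bool" where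
  "error_trajectory A B C D E F G2 K \<Xi> r \<zeta>t \<longleftrightarrow>
     (\<exists>x z w u e \<zeta> \<epsilon>.
        closed_loop A B C D E F G2 K r x z w u e \<and>
        (\<forall>k. \<zeta> k = vstack (x k) (z k)) \<and>
        (\<forall>k. \<zeta>t k = \<zeta> k - \<Xi> *v w k) \<and>
        (\<forall>k. \<epsilon> k = \<zeta> (r k) - \<zeta> k) \<and>
        (\<forall>k. \<epsilon> k = \<zeta>t (r k) - \<zeta>t k) \<and>
        (\<forall>k. \<zeta>t (Suc k) =
           (block A 0 (G2 ** C) E - stack B 0 ** K) *v \<zeta>t k - (stack B 0 ** K) *v \<epsilon> k
           + vstack 0 (G2 *v (beside C 0 *v \<epsilon> k))) \<and>
        (\<forall>k. e k = beside C 0 *v \<zeta>t k))"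

definition globally_asymptotically_stable :: "(nat \<Rightarrow> 'a::real_normed_vector) set \<Rightarrow> bool" where
  "globally_asymptotically_stable S \<longleftrightarrow>
     (\<forall>\<epsilon>>0. \<exists>\<delta>>0. \<forall>s\<in>S. norm (s 0) < \<delta> \<longrightarrow> (\<forall>k. norm (s k) < \<epsilon>)) \<and>
     (\<forall>s\<in>S. s \<longlonglongrightarrow> 0)"

lemma vstack_add: "vstack a b + vstack c d = vstack (a + c) (b + d)"
  by (simp add: vstack_def vec_eq_iff split: sum.splits)

lemma vstack_diff: "vstack a b - vstack c d = vstack (a - c) (b - d)" for a :: "'a::ab_group_add ^ _"
  by (simp add: vstack_def vec_eq_iff split: sum.splits)

lemma vstack_split: "vstack (\<chi> i. v $ Inl i) (\<chi> i. v $ Inr i) = v"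
  by (simp add: vstack_def vec_eq_iff split: sum.splits)

lemma stack_mult_vec: "stack M N *v v = vstack (M *v v) (N *v v)"
  by (simp add: stack_def vstack_def matrix_vector_mult_def vec_eq_iff split: sum.splits)

lemma beside_mult_vec: "beside M N *v vstack x z = M *v x + N *v z"
proof -
  have *: "(\<Sum>j\<in>UNIV. f j) = (\<Sum>a\<in>UNIV. f (Inl a)) + (\<Sum>b\<in>UNIV. f (Inr b))"
    for f :: "'x::finite + 'y::finite \<Rightarrow> 'z::comm_monoid_add"
    by (subst UNIV_sum, subst sum.union_disjoint) (auto simp: sum.reindex)
  show ?thesis
    by (simp add: beside_def vstack_def matrix_vector_mult_def vec_eq_iff *)
qed

text \<open>
  Every solution of the error recursion is an error trajectory (take \<open>w = 0\<close>), so the embedding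
  into the closed loop does not restrict the solutions under consideration.
\<close>

lemma error_trajectory_iff:
  "error_trajectory A B C D E F G2 K \<Xi> r \<zeta>t \<longleftrightarrow>
     (\<forall>k. \<zeta>t (Suc k) =
        (block A 0 (G2 ** C) E - stack B 0 ** K) *v \<zeta>t k
        - (stack B 0 ** K) *v (\<zeta>t (r k) - \<zeta>t k)
        + vstack 0 (G2 *v (beside C 0 *v (\<zeta>t (r k) - \<zeta>t k))))"
  (is "_ \<longleftrightarrow> ?rec")
proof
  assume "error_trajectory A B C D E F G2 K \<Xi> r \<zeta>t"
  then show ?rec unfolding error_trajectory_def by metis
next
  assume rec: ?rec
  define x where "x k = (\<chi> i. \<zeta>t k $ Inl i)" for k
  define z where "z k = (\<chi> i. \<zeta>t k $ Inr i)" for k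
  have xz: "\<zeta>t k = vstack (x k) (z k)" for k
    by (simp add: x_def z_def vstack_split)
  define u where "u k = - (K *v vstack (x (r k)) (z (r k)))" for k
  have vinj: "vstack a b = vstack c d \<Longrightarrow> a = c \<and> b = d"
    for a c :: "real ^ 'a" and b d :: "real ^ 'b"
    by (auto simp: vstack_def vec_eq_iff split: sum.splits)
  have Kdiff: "K *v vstack (x (r k) - x k) (z (r k) - z k)
      = K *v vstack (x (r k)) (z (r k)) - K *v vstack (x k) (z k)" for k
    by (simp add: matrix_vector_mult_diff_distrib flip: vstack_diff)
  have Bneg: "B *v (- v) = - (B *v v)" for v
    using matrix_vector_mult_diff_distrib[of B 0 v] by simp
  have step: "x (Suc k) = A *v x k + B *v u k \<and> z (Suc k) = E *v z k + G2 *v (C *v x (r k))" for k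
    using rec[rule_format, of k] unfolding xz
    by (intro vinj) (simp add: block_def stack_mult_vec beside_mult_vec vstack_add vstack_diff u_def
        Kdiff Bneg algebra_simps flip: matrix_vector_mul_assoc)
  show "error_trajectory A B C D E F G2 K \<Xi> r \<zeta>t"
    unfolding error_trajectory_def
  proof (intro exI conjI allI)
    show "closed_loop A B C D E F G2 K r x z (\<lambda>_. 0) u (\<lambda>k. C *v x k)"
      using step by (simp add: closed_loop_def u_def)
  qed (use rec in \<open>simp_all add: xz beside_mult_vec\<close>)
qed

end

theory Submission
  imports Defs "HOL-Computational_Algebra.Fundamental_Theorem_Algebra"
begin

text \<open>
  With \<open>V v = v\<^sup>T P v\<close>, the Riccati equation gives \<open>V (\<zeta>\<^sub>k\<^sub>+\<^sub>1) \<le> (1 - \<omega>1) V (\<zeta>\<^sub>k)\<close> whenever the state is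
  received. At a denied instant the held sample \<open>\<zeta>\<^sub>r\<close> precedes the attack by one step, and \<open>V (\<zeta>\<^sub>r)\<close> may
  exceed the decay estimate valid at the beginning of the attack by a factor \<open>1 / (1 - \<omega>1)\<close>. A loss of
  this factor at each attack would spoil the bound on \<open>T\<close>, since the frequency of the attacks is arbitrary.
  The loss is absorbed by \<open>\<omega>2\<close>: the matrix \<open>E\<close> has an eigenvalue on the unit circle, so that the
  closed loop does not contract some vector \<open>v\<close>, which forces \<open>\<omega>1 \<le> 1 / 2\<close>, and the slack in the
  definition of \<open>\<omega>2\<close> covers a factor \<open>2\<close> on \<open>V (\<zeta>\<^sub>r)\<close>. Hence
  \<open>W k = max (V \<zeta>\<^sub>k) ((1 - \<omega>1) V (\<zeta>\<^sub>s))\<close>, where \<open>\<zeta>\<^sub>s\<close> is the sample held at time \<open>k - 1\<close>, decays by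
  \<open>1 - \<omega>1\<close> at allowed instants and grows by at most \<open>1 + \<omega>2\<close> at denied ones, and the duration
  assumption bounds the number of denied instants below \<open>k\<close> by \<open>\<kappa> + k / T\<close>.
\<close>

section \<open>Eigenvalues and quadratic forms\<close>

lemma poly_det: "poly (det M) x = det (\<chi> i j. poly (M $ i $ j) x)"
  for M :: "'a::comm_ring_1 poly ^ 'n ^ 'n"
  by (simp add: det_def poly_sum poly_prod)

lemma poly_charpoly: "poly (charpoly M) l = det (mat l - M)"
  for M :: "'a::comm_ring_1 ^ 'n ^ 'n"
  unfolding charpoly_def poly_det
  by (rule arg_cong[where f = det]) (simp add: vec_eq_iff mat_def)

lemma mat_mult_vec: "mat l *v v = l *s v" for v :: "'a::comm_semiring_1 ^ 'n"
proof -
  have "(\<Sum>j\<in>UNIV. (if i = j then l else 0) * v $ j) = (\<Sum>j\<in>UNIV. if i = j then l * v $ j else 0)" for i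
    by (rule sum.cong) auto
  then show ?thesis
    by (simp add: vec_eq_iff matrix_vector_mult_def mat_def)
qed

text \<open>Eigenvectors are the nonzero elements of the kernel of \<open>mat l - M\<close>. Passing
  to polynomial roots gives finiteness of the spectrum, and nonemptiness over the complex
  numbers.\<close>

lemma eigenvalues_iff_charpoly: "l \<in> eigenvalues M \<longleftrightarrow> poly (charpoly M) l = 0"
  for M :: "'a::field ^ 'n ^ 'n"
proof -
  have "l \<in> eigenvalues M \<longleftrightarrow> (\<exists>v. (mat l - M) *v v = 0 \<and> v \<noteq> 0)"
    unfolding eigenvalues_def matrix_vector_mult_diff_rdistrib mat_mult_vec mem_Collect_eq right_minus_eq
    by metis
  also have "\<dots> \<longleftrightarrow> \<not> (\<exists>N. N ** (mat l - M) = mat 1)"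
    using matrix_left_invertible_ker[of "mat l - M"] by blast
  also have "\<dots> \<longleftrightarrow> det (mat l - M) = 0"
    using invertible_det_nz[of "mat l - M"] by (auto simp: invertible_left_inverse)
  finally show ?thesis by (simp add: poly_charpoly)
qed

text \<open>If the polynomial were a constant \<open>c\<close>, then \<open>det (1 - M / l) = c / l\<^sup>n\<close> would tend both to
  \<open>1\<close> and to \<open>0\<close> as \<open>l\<close> grows.\<close>

lemma nonconstant_charpoly: "\<not> constant (poly (charpoly M))"
  for M :: "'a::real_normed_field ^ 'n ^ 'n"
proof
  assume "constant (poly (charpoly M))"
  then obtain c where c: "det (mat l - M) = c" for l
    unfolding constant_def poly_charpoly by metis
  define x where "x k = (inverse (of_nat (Suc k)) :: 'a)" for k
  have x0: "x k \<noteq> 0" for k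
    unfolding x_def using of_nat_neq_0[of k] by (metis nonzero_imp_inverse_nonzero)
  have x_lim: "x \<longlonglongrightarrow> 0"
    unfolding x_def by (rule LIMSEQ_Suc) (rule lim_inverse_n)
  have "det (mat 1 - (\<chi> i j. x k * M $ i $ j)) = x k ^ CARD('n) * c" for k
  proof -
    have "mat 1 - (\<chi> i j. x k * M $ i $ j) = (\<chi> i. x k *s (mat (inverse (x k)) - M) $ i)"
      using x0[of k] by (auto simp: vec_eq_iff mat_def algebra_simps)
    also have "det \<dots> = x k ^ CARD('n) * c"
      by (subst det_rows_mul) (simp add: c)
    finally show ?thesis .
  qed
  moreover have "(\<lambda>k. x k ^ CARD('n) * c) \<longlonglongrightarrow> 0 ^ CARD('n) * c"
    by (intro tendsto_intros x_lim)
  moreover have "(\<lambda>k. det (mat 1 - (\<chi> i j. x k * M $ i $ j)))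
      \<longlonglongrightarrow> det (mat 1 - (\<chi> i j. 0 * M $ i $ j))"
    unfolding det_def by (simp only: vec_lambda_beta vector_minus_component) (intro tendsto_intros x_lim)
  moreover have "mat 1 - (\<chi> i j. 0 * M $ i $ j) = mat 1"
    by (simp add: vec_eq_iff)
  \<comment> \<open>\<open>CARD('n)\<close> is positive, so \<open>0 ^ CARD('n)\<close>
    vanishes.\<close>
  ultimately have "(\<lambda>k. x k ^ CARD('n) * c) \<longlonglongrightarrow> 0" "(\<lambda>k. x k ^ CARD('n) * c) \<longlonglongrightarrow> 1"
    by (simp_all add: power_0_left)
  then show False
    using LIMSEQ_unique zero_neq_one by blast
qed

text \<open>\<open>lambda_min\<close> and \<open>lambda_max\<close> are a \<open>Min\<close> and a
  \<open>Max\<close>, which are informative only on finite sets.\<close>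

lemma finite_eigenvalues: "finite (eigenvalues M)" for M :: "'a::real_normed_field ^ 'n ^ 'n"
proof -
  have "charpoly M \<noteq> 0"
    using nonconstant_charpoly[of M] by (auto simp: constant_def)
  moreover have "eigenvalues M = {l. poly (charpoly M) l = 0}"
    using eigenvalues_iff_charpoly by blast
  ultimately show ?thesis
    by (simp add: poly_roots_finite)
qed

lemma eigenvalues_complex_nonempty: "eigenvalues M \<noteq> {}" for M :: "complex ^ 'n ^ 'n"
  using fundamental_theorem_of_algebra[OF nonconstant_charpoly[of M]]
  by (auto simp: eigenvalues_iff_charpoly)

text \<open>A real matrix acts separately on the real and imaginary parts of a complex eigenvector,
  and the squared norms of the parts add up to that of the vector. As the eigenvector is not shrunk,
  its parts cannot both be shrunk.\<close>

lemma spec_norm_ge: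
  fixes E :: "real ^ 'q ^ 'q"
  assumes unit: "\<And>l. l \<in> spec E \<Longrightarrow> 1 \<le> cmod l"
  obtains z where "z \<noteq> 0" "norm z \<le> norm (E *v z)"
proof -
  obtain l v where lv: "cmat E *v v = l *s v" "v \<noteq> 0" and l: "1 \<le> cmod l"
    using eigenvalues_complex_nonempty[of "cmat E"] unit
    by (auto simp: spec_def eigenvalues_def)
  define re im where "re u = (\<chi> i. Re (u $ i))" and "im u = (\<chi> i. Im (u $ i))" for u :: "complex ^ 'q"
  have norm_sq: "(norm u)\<^sup>2 = (norm (re u))\<^sup>2 + (norm (im u))\<^sup>2" for u
    by (simp add: norm_vec_def L2_set_def sum_nonneg re_def im_def cmod_power2 sum.distrib)
  have re: "re (cmat E *v v) = E *v re v" and im: "im (cmat E *v v) = E *v im v"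
    by (simp_all add: vec_eq_iff re_def im_def cmat_def matrix_vector_mult_def Re_sum Im_sum)
  have "norm (l *s v) = cmod l * norm v"
    by (simp add: norm_vec_def L2_set_def norm_mult power_mult_distrib real_sqrt_mult
        flip: sum_distrib_left)
  then have "norm v \<le> norm (cmat E *v v)"
    using l by (simp add: lv mult_le_cancel_right1)
  then have "(norm v)\<^sup>2 \<le> (norm (cmat E *v v))\<^sup>2"
    by (simp add: power_mono)
  then have le: "(norm (re v))\<^sup>2 + (norm (im v))\<^sup>2 \<le> (norm (E *v re v))\<^sup>2 + (norm (E *v im v))\<^sup>2"
    by (simp add: norm_sq re im)
  have "re v \<noteq> 0 \<or> im v \<noteq> 0"
    using norm_sq[of v] \<open>v \<noteq> 0\<close> by auto
  moreover have "norm z \<le> norm (E *v z)" if "(norm z)\<^sup>2 \<le> (norm (E *v z))\<^sup>2" for z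
    using that by (simp add: power2_le_iff_abs_le)
  \<comment> \<open>A vanishing part drops out of both sides of \<open>le\<close>, which leaves the
    inequality for the other, nonzero part.\<close>
  moreover have "(norm (E *v z))\<^sup>2 = (norm z)\<^sup>2" if "z = 0" for z
    using that by simp
  ultimately show ?thesis
    using le that by (smt (verit, best))
qed

section \<open>Quadratic forms of symmetric matrices\<close>

lemma quadform_minus: "v \<bullet> ((- M) *v v) = - (v \<bullet> (M *v v))" for M :: "real ^ 'n ^ 'n"
  using matrix_vector_mult_diff_rdistrib[of 0 M v] by simp

lemma symmetric_inner: "u \<bullet> (M *v v) = (M *v u) \<bullet> v" if "transpose M = M" for M :: "real ^ 'n ^ 'n"
  using dot_lmul_matrix[of u M v] that by (metis transpose_matrix_vector)

lemma quadform_add: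
  fixes M :: "real ^ 'n ^ 'n"
  assumes "transpose M = M"
  shows "(u + v) \<bullet> (M *v (u + v)) = u \<bullet> (M *v u) + 2 * (u \<bullet> (M *v v)) + v \<bullet> (M *v v)"
  using symmetric_inner[OF assms, of v u]
  by (simp add: matrix_vector_right_distrib inner_add_left inner_add_right inner_commute)

text \<open>A minimizer of the quadratic form on the unit sphere is an eigenvector.\<close>

lemma symmetric_rayleigh_min:
  fixes M :: "real ^ 'n ^ 'n"
  assumes sym: "transpose M = M"
  obtains l where "l \<in> eigenvalues M" "\<And>v. l * (norm v)\<^sup>2 \<le> v \<bullet> (M *v v)"
proof -
  have "continuous_on (sphere 0 1) (\<lambda>v. v \<bullet> (M *v v))"
    by (intro continuous_intros linear_continuous_on matrix_vector_mul_bounded_linear)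
  moreover have "sphere 0 1 \<noteq> ({} :: (real ^ 'n) set)" by simp
  ultimately obtain u where u: "norm u = 1"
    and u_min: "\<And>v. norm v = 1 \<Longrightarrow> u \<bullet> (M *v u) \<le> v \<bullet> (M *v v)"
    using continuous_attains_inf[OF compact_sphere, of 0 1 "\<lambda>v. v \<bullet> (M *v v)"] by fastforce
  define l where "l = u \<bullet> (M *v u)"
  have l_le: "l * (norm v)\<^sup>2 \<le> v \<bullet> (M *v v)" for v
  proof (cases "v = 0")
    case False
    define w where "w = inverse (norm v) *\<^sub>R v"
    have v: "v = norm v *\<^sub>R w" and "norm w = 1"
      using False by (simp_all add: w_def)
    have "l \<le> w \<bullet> (M *v w)"
      using u_min \<open>norm w = 1\<close> by (simp add: l_def)
    then have "l * (norm v)\<^sup>2 \<le> (w \<bullet> (M *v w)) * (norm v)\<^sup>2"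
      by (intro mult_right_mono) auto
    also have "\<dots> = v \<bullet> (M *v v)"
      using matrix_vector_mult_scaleR[of M "norm v" w] v
      by (metis inner_scaleR_left inner_scaleR_right mult.commute mult.left_commute power2_eq_square)
    finally show ?thesis .
  qed simp
  define N where "N = M - mat l"
  have N_symm: "transpose N = N"
    using sym by (auto simp: N_def vec_eq_iff transpose_def mat_def)
  have N_mult: "N *v v = M *v v - l *\<^sub>R v" for v
    by (simp add: N_def matrix_vector_mult_diff_rdistrib mat_mult_vec scalar_mult_eq_scaleR)
  have N_nonneg: "0 \<le> v \<bullet> (N *v v)" for v
    using l_le[of v] by (simp add: N_mult inner_diff_right dot_square_norm)
  have N_u: "u \<bullet> (N *v u) = 0"
    using u by (simp add: N_mult inner_diff_right dot_square_norm l_def)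
  define y where "y = N *v u"
  \<comment> \<open>The form of \<open>N\<close> is nonnegative and vanishes at \<open>u\<close>.
    Along \<open>- y\<close> its linear term \<open>- 2 * t * (y \<bullet> y)\<close> would make it
    negative for small \<open>t > 0\<close>, unless \<open>y = 0\<close>.\<close>
  have "0 \<le> - 2 * t * (y \<bullet> y) + t\<^sup>2 * (y \<bullet> (N *v y))" for t
  proof -
    have "0 \<le> (u + (- t) *\<^sub>R y) \<bullet> (N *v (u + (- t) *\<^sub>R y))" by (rule N_nonneg)
    also have "\<dots> = - 2 * t * (u \<bullet> (N *v y)) + t\<^sup>2 * (y \<bullet> (N *v y))"
      unfolding quadform_add[OF N_symm] N_u
      using matrix_vector_mult_scaleR[of N "- t" y] by (simp add: power2_eq_square)
    also have "u \<bullet> (N *v y) = y \<bullet> y"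
      by (simp add: symmetric_inner[OF N_symm] y_def)
    finally show ?thesis .
  qed
  note quad = this
  have "y \<bullet> y = 0"
  proof (rule ccontr)
    assume "y \<bullet> y \<noteq> 0"
    then have pos: "0 < y \<bullet> y" by simp
    let ?b = "y \<bullet> (N *v y)"
    \<comment> \<open>This \<open>t\<close> keeps the quadratic term at most half the size of the
      linear one; the summand \<open>1\<close> keeps the denominator positive when \<open>?b\<close>
      is zero.\<close>
    define t where "t = (y \<bullet> y) / (1 + ?b)"
    have b: "0 \<le> ?b" by (rule N_nonneg)
    have t: "0 < t" using pos b by (simp add: t_def)
    have "t * ?b \<le> y \<bullet> y"
      using pos b by (simp add: t_def field_simps)
    then have "t\<^sup>2 * ?b \<le> t * (y \<bullet> y)"
      using t by (simp add: power2_eq_square mult.assoc)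
    then show False
      using quad[of t] mult_pos_pos[OF t pos] by linarith
  qed
  then have "M *v u = l *s u"
    by (simp add: y_def N_mult scalar_mult_eq_scaleR)
  then have "l \<in> eigenvalues M"
    using u by (auto simp: eigenvalues_def intro!: exI[of _ u])
  with l_le that show ?thesis by blast
qed

lemma lambda_min_le:
  fixes M :: "real ^ 'n ^ 'n"
  assumes "transpose M = M"
  shows "lambda_min M * (norm v)\<^sup>2 \<le> v \<bullet> (M *v v)"
proof -
  obtain l where l: "l \<in> eigenvalues M" "l * (norm v)\<^sup>2 \<le> v \<bullet> (M *v v)"
    using symmetric_rayleigh_min[OF assms] by metis
  have "lambda_min M \<le> l"
    unfolding lambda_min_def using finite_eigenvalues l(1) by (rule Min_le)
  then show ?thesis
    using l(2) by (meson mult_right_mono order_trans zero_le_power2)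
qed

text \<open>The minimization is applied to \<open>- M\<close>, whose eigenvalues are the negatives
  of those of \<open>M\<close>.\<close>

lemma lambda_max_ge:
  fixes M :: "real ^ 'n ^ 'n"
  assumes "transpose M = M"
  shows "v \<bullet> (M *v v) \<le> lambda_max M * (norm v)\<^sup>2"
proof -
  have "transpose (- M) = - M"
    using assms by (simp add: vec_eq_iff transpose_def)
  then obtain l where l: "l \<in> eigenvalues (- M)" "l * (norm v)\<^sup>2 \<le> v \<bullet> ((- M) *v v)"
    using symmetric_rayleigh_min by metis
  from l(1) obtain w where w: "w \<noteq> 0" "(- M) *v w = l *s w"
    by (auto simp: eigenvalues_def)
  have "M *v w = - ((- M) *v w)"
    using matrix_vector_mult_diff_rdistrib[of 0 M w] by simp
  also have "\<dots> = (- l) *s w"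
    unfolding w by (simp add: vec_eq_iff)
  finally have "- l \<in> eigenvalues M"
    using w(1) unfolding eigenvalues_def by blast
  then have "- l \<le> lambda_max M"
    unfolding lambda_max_def using finite_eigenvalues by (rule Max_ge[rotated])
  then have "- l * (norm v)\<^sup>2 \<le> lambda_max M * (norm v)\<^sup>2"
    by (intro mult_right_mono) auto
  then show ?thesis
    using l(2) by (simp add: quadform_minus)
qed

lemma lambda_min_attained:
  fixes M :: "real ^ 'n ^ 'n"
  assumes "transpose M = M"
  obtains v where "v \<noteq> 0" "v \<bullet> (M *v v) = lambda_min M * (norm v)\<^sup>2"
proof -
  have "eigenvalues M \<noteq> {}"
    using symmetric_rayleigh_min[OF assms] by blast
  then have "lambda_min M \<in> eigenvalues M"
    unfolding lambda_min_def using finite_eigenvalues by (rule Min_in[rotated])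
  then obtain v where v: "v \<noteq> 0" "M *v v = lambda_min M *s v"
    unfolding eigenvalues_def by blast
  show ?thesis
    by (rule that[OF v(1)]) (simp add: v(2) scalar_mult_eq_scaleR dot_square_norm)
qed

lemma sym_posdef_lambda_min_pos:
  assumes "sym_posdef M"
  shows "0 < lambda_min M"
proof -
  have "transpose M = M" using assms by (simp add: sym_posdef_def)
  then obtain v where "v \<noteq> 0" "v \<bullet> (M *v v) = lambda_min M * (norm v)\<^sup>2"
    by (rule lambda_min_attained)
  then have "0 < lambda_min M * (norm v)\<^sup>2"
    using assms by (metis sym_posdef_def)
  then show ?thesis
    using \<open>v \<noteq> 0\<close> by (simp add: zero_less_mult_iff)
qed

lemma inner_vector_matrix_mult: "u \<bullet> (v v* M) = (M *v u) \<bullet> v" for M :: "real ^ 'n ^ 'm"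
  using dot_lmul_matrix[of v M u] by (simp add: inner_commute)

lemma matrix_vector_mult_minus: "M *v (- v) = - (M *v v)" for M :: "real ^ 'n ^ 'm"
  using matrix_vector_mult_diff_distrib[of M 0 v] by simp

text \<open>Cauchy-Schwarz; this is how the matrix norms in \<alpha>1 and \<alpha>2 enter the
  estimates.\<close>

lemma mult_quadform_le:
  fixes P :: "real ^ 'n ^ 'n" and M :: "real ^ 'm ^ 'n"
  shows "(M *v v) \<bullet> (P *v (M *v v)) \<le> mnorm (transpose M ** P ** M) * (norm v)\<^sup>2"
proof -
  let ?N = "transpose M ** P ** M"
  have "(M *v v) \<bullet> (P *v (M *v v)) = v \<bullet> (?N *v v)"
    by (simp add: inner_vector_matrix_mult flip: matrix_vector_mul_assoc)
  also have "\<dots> \<le> norm v * norm (?N *v v)"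
    by (rule norm_cauchy_schwarz)
  also have "\<dots> \<le> norm v * (mnorm ?N * norm v)"
    unfolding mnorm_def
    by (intro mult_left_mono onorm matrix_vector_mul_bounded_linear) auto
  finally show ?thesis by (simp add: power2_eq_square mult_ac)
qed

lemma mnorm_nonneg: "0 \<le> mnorm M"
  unfolding mnorm_def by (intro onorm_pos_le matrix_vector_mul_bounded_linear)

text \<open>The right side minus the left side is the sum of the form over the three pairwise
  differences.\<close>

lemma quadform_add3_le:
  fixes P :: "real ^ 'n ^ 'n"
  assumes sym: "transpose P = P" and nonneg: "\<And>v. 0 \<le> v \<bullet> (P *v v)"
  shows "(p + q + r) \<bullet> (P *v (p + q + r))
    \<le> 3 * (p \<bullet> (P *v p) + q \<bullet> (P *v q) + r \<bullet> (P *v r))"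
proof -
  have "0 \<le> (p - q) \<bullet> (P *v (p - q)) + (q - r) \<bullet> (P *v (q - r)) + (p - r) \<bullet> (P *v (p - r))"
    by (intro add_nonneg_nonneg nonneg)
  moreover have "x \<bullet> (P *v y) = y \<bullet> (P *v x)" for x y
    by (metis symmetric_inner[OF sym] inner_commute)
  ultimately show ?thesis
    by (simp add: matrix_vector_right_distrib matrix_vector_mult_diff_distrib
        inner_add_left inner_add_right inner_diff_left inner_diff_right)
qed

section \<open>The closed-loop quadratic form\<close>

text \<open>Since \<open>S ** K = transpose B ** P ** A\<close>, the cross term of
  \<open>A *v v\<close> and \<open>B *v (K *v v)\<close> is \<open>(norm (K *v v))\<^sup>2\<close>
  plus the form at \<open>B *v (K *v v)\<close>. Inserting this into the Riccati equation cancels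
  all other terms in \<open>B\<close>.\<close>

lemma riccati_closed_loop:
  fixes A P Q :: "real ^ 'n ^ 'n" and B :: "real ^ 'p ^ 'n" and K :: "real ^ 'n ^ 'p"
  assumes P: "sym_posdef P"
    and riccati: "transpose A ** P ** A - P + Q
          - transpose A ** P ** B ** matrix_inv (mat 1 + transpose B ** P ** B)
            ** transpose B ** P ** A = 0"
    and K: "K = matrix_inv (mat 1 + transpose B ** P ** B) ** transpose B ** P ** A"
  shows "((A - B ** K) *v v) \<bullet> (P *v ((A - B ** K) *v v))
    = v \<bullet> (P *v v) - v \<bullet> (Q *v v) - (norm (K *v v))\<^sup>2"
proof -
  have sym: "transpose P = P" and pos: "\<And>v. v \<noteq> 0 \<Longrightarrow> 0 < v \<bullet> (P *v v)"
    using P by (auto simp: sym_posdef_def)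
  define S where "S = mat 1 + transpose B ** P ** B"
  have S_mult: "S *v y = y + transpose B *v (P *v (B *v y))" for y
    by (simp add: S_def matrix_vector_mult_add_rdistrib flip: matrix_vector_mul_assoc)
  have "y = 0" if "S *v y = 0" for y
  proof -
    have "0 = y \<bullet> (S *v y)" using that by simp
    also have "\<dots> = (norm y)\<^sup>2 + (B *v y) \<bullet> (P *v (B *v y))"
      by (simp add: S_mult inner_add_right inner_vector_matrix_mult dot_square_norm)
    finally show ?thesis
      using pos[of "B *v y"] zero_le_power2[of "norm y"]
      by (cases "B *v y = 0") (simp, linarith)
  qed
  then have "invertible S"
    using matrix_left_invertible_ker[of S] by (auto simp: invertible_left_inverse)
  \<comment> \<open>\<open>matrix_inv\<close> is defined by choice and is known to be an inverse
    only once \<open>S\<close> is invertible.\<close>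
  then have "S ** matrix_inv S = mat 1"
    unfolding invertible_def matrix_inv_def by (rule someI2_ex) simp
  then have "S ** K = transpose B ** P ** A"
    unfolding K S_def[symmetric] by (metis matrix_mul_assoc matrix_mul_lid)
  then have "S *v (K *v v) = transpose B *v (P *v (A *v v))"
    by (metis matrix_vector_mul_assoc)
  then have "(K *v v) \<bullet> (S *v (K *v v)) = (B *v (K *v v)) \<bullet> (P *v (A *v v))"
    by (simp add: inner_vector_matrix_mult)
  then have cross: "(B *v (K *v v)) \<bullet> (P *v (A *v v))
      = (norm (K *v v))\<^sup>2 + (B *v (K *v v)) \<bullet> (P *v (B *v (K *v v)))"
    by (simp add: S_mult inner_add_right inner_vector_matrix_mult dot_square_norm)
  have "transpose A ** P ** A + Q = P + transpose A ** P ** B ** K"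
    using riccati by (simp add: K matrix_mul_assoc algebra_simps)
  then have "v \<bullet> ((transpose A ** P ** A + Q) *v v) = v \<bullet> ((P + transpose A ** P ** B ** K) *v v)"
    by simp
  then have are: "(A *v v) \<bullet> (P *v (A *v v)) + v \<bullet> (Q *v v)
      = v \<bullet> (P *v v) + (A *v v) \<bullet> (P *v (B *v (K *v v)))"
    by (simp add: matrix_vector_mult_add_rdistrib inner_add_right inner_vector_matrix_mult
        flip: matrix_vector_mul_assoc)
  have "x \<bullet> (P *v y) = y \<bullet> (P *v x)" for x y
    by (metis symmetric_inner[OF sym] inner_commute)
  with cross are show ?thesis
    by (simp add: matrix_vector_mult_diff_rdistrib matrix_vector_mult_diff_distrib
        inner_diff_left inner_diff_right flip: matrix_vector_mul_assoc)
qed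

lemma inner_vstack: "vstack a b \<bullet> vstack c d = a \<bullet> c + b \<bullet> d"
  for a c :: "real ^ 'm" and b d :: "real ^ 'k"
proof -
  have *: "(\<Sum>j\<in>UNIV. f j) = (\<Sum>a\<in>UNIV. f (Inl a)) + (\<Sum>b\<in>UNIV. f (Inr b))"
    for f :: "'m + 'k \<Rightarrow> real"
    by (subst UNIV_sum, subst sum.union_disjoint) (auto simp: sum.reindex)
  show ?thesis
    by (simp add: inner_vec_def vstack_def *)
qed

lemma norm_vstack: "(norm (vstack a b))\<^sup>2 = (norm a)\<^sup>2 + (norm b)\<^sup>2"
  for a :: "real ^ 'm" and b :: "real ^ 'k"
  by (simp add: inner_vstack flip: dot_square_norm)

text \<open>An eigenvalue of modulus at least one caps the decay rate at a half: on some vector \<open>v\<close> the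
  closed loop does not contract, so \<open>P\<close> exceeds \<open>Q\<close> there by at least the least eigenvalue of \<open>P\<close>.\<close>

lemma decay_rate_le_half:
  fixes M P Q :: "real ^ 'n ^ 'n"
  assumes P: "sym_posdef P" and Q: "sym_posdef Q"
    and lyap: "\<And>v. (M *v v) \<bullet> (P *v (M *v v)) + v \<bullet> (Q *v v) \<le> v \<bullet> (P *v v)"
    and v: "v \<noteq> 0" "norm v \<le> norm (M *v v)"
  shows "lambda_min Q / lambda_max P \<le> 1 / 2"
proof -
  have symP: "transpose P = P" and symQ: "transpose Q = Q"
    using P Q by (auto simp: sym_posdef_def)
  have pos: "0 < lambda_min P" "0 < lambda_min Q"
    using P Q by (auto intro: sym_posdef_lambda_min_pos)
  \<comment> \<open>Testing \<open>lyap\<close> where the form of \<open>P\<close> attains its least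
    ratio to the squared norm compares the two least eigenvalues.\<close>
  obtain u where u: "u \<noteq> 0" "u \<bullet> (P *v u) = lambda_min P * (norm u)\<^sup>2"
    using lambda_min_attained[OF symP] .
  have "0 \<le> (M *v u) \<bullet> (P *v (M *v u))"
    using lambda_min_le[OF symP, of "M *v u"] pos by (smt (verit) mult_nonneg_nonneg zero_le_power2)
  then have "lambda_min Q * (norm u)\<^sup>2 \<le> lambda_min P * (norm u)\<^sup>2"
    using lambda_min_le[OF symQ, of u] lyap[of u] u by linarith
  then have le: "lambda_min Q \<le> lambda_min P"
    using u by simp
  have "(norm v)\<^sup>2 \<le> (norm (M *v v))\<^sup>2"
    using v by (simp add: power_mono)
  then have "lambda_min Q * (norm v)\<^sup>2 \<le> lambda_min P * (norm (M *v v))\<^sup>2"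
    using le pos by (intro mult_mono) auto
  then have "(2 * lambda_min Q) * (norm v)\<^sup>2 \<le> lambda_max P * (norm v)\<^sup>2"
    using lambda_min_le[OF symP, of "M *v v"] lambda_min_le[OF symQ, of v] lyap[of v]
      lambda_max_ge[OF symP, of v] by linarith
  then have "2 * lambda_min Q \<le> lambda_max P"
    using v by simp
  then show ?thesis
    using pos by (simp add: field_simps)
qed

section \<open>Denied instants and switched decay\<close>

definition under_attack :: "(nat \<Rightarrow> nat) \<Rightarrow> (nat \<Rightarrow> nat) \<Rightarrow> nat \<Rightarrow> bool" where
  "under_attack h \<tau> j \<longleftrightarrow> (\<exists>m. h m \<le> j \<and> j < h m + \<tau> m)"

lemma mem_attack_interval:
  "real j \<in> attack_interval h \<tau> m \<longleftrightarrow> h m \<le> j \<and> j < h m + \<tau> m"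
  by (simp add: attack_interval_def flip: of_nat_add)

lemma mem_allowed: "real j \<in> allowed h \<tau> 0 (real k) \<longleftrightarrow> j \<le> k \<and> \<not> under_attack h \<tau> j"
  by (auto simp: allowed_def denied_def under_attack_def mem_attack_interval)

lemma last_update_altdef: "last_update h \<tau> k = Max (insert 0 {j. j \<le> k \<and> \<not> under_attack h \<tau> j})"
  by (simp add: last_update_def mem_allowed)

lemma last_update_allowed: "last_update h \<tau> k = k" if "\<not> under_attack h \<tau> k"
  unfolding last_update_altdef using that by (intro Max_eqI) auto

text \<open>This includes \<open>k = 0\<close>, where \<open>k - 1\<close> is again
  \<open>0\<close>.\<close>

lemma last_update_denied: "last_update h \<tau> k = last_update h \<tau> (k - 1)" if "under_attack h \<tau> k"
proof -
  have "insert 0 {j. j \<le> k \<and> \<not> under_attack h \<tau> j}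
      = insert 0 {j. j \<le> k - 1 \<and> \<not> under_attack h \<tau> j}"
  proof -
    have "j \<le> k - 1" if "j \<le> k" "\<not> under_attack h \<tau> j" for j
      using that \<open>under_attack h \<tau> k\<close> by (cases "j = k") auto
    then show ?thesis by auto
  qed
  then show ?thesis by (simp add: last_update_altdef)
qed

lemma last_update_0: "last_update h \<tau> 0 = 0"
  unfolding last_update_altdef by (intro Max_eqI) auto

text \<open>Attacks have integer endpoints, so a denied instant \<open>j\<close> denies the whole
  unit interval from \<open>j\<close> to \<open>j + 1\<close>. These half-open intervals are
  disjoint, and \<open>j < k\<close> keeps them below \<open>k\<close>.\<close>

lemma card_under_attack_le:
  "real (card {j. j < k \<and> under_attack h \<tau> j}) \<le> measure lborel (denied h \<tau> 0 (real k))"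
proof -
  let ?J = "{j. j < k \<and> under_attack h \<tau> j}"
  let ?I = "\<lambda>j::nat. {real j..<real j + 1}"
  have fin: "finite ?J" by simp
  have "disjoint_family_on ?I ?J"
    unfolding disjoint_family_on_def
  proof (intro ballI impI)
    fix i j :: nat assume "i \<noteq> j"
    then have "real i + 1 \<le> real j \<or> real j + 1 \<le> real i" by linarith
    then show "?I i \<inter> ?I j = {}" by auto
  qed
  then have "measure lborel (\<Union>j\<in>?J. ?I j) = (\<Sum>j\<in>?J. measure lborel (?I j))"
    by (intro measure_finite_Union[OF fin]) auto
  then have "real (card ?J) = measure lborel (\<Union>j\<in>?J. ?I j)"
    by simp
  also have "\<dots> \<le> measure lborel (denied h \<tau> 0 (real k))"
  proof (rule measure_mono_fmeasurable)
    show "(\<Union>j\<in>?J. ?I j) \<subseteq> denied h \<tau> 0 (real k)"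
    proof safe
      fix j x assume "j < k" "under_attack h \<tau> j" and x: "x \<in> ?I j"
      then obtain m where "h m \<le> j" "j < h m + \<tau> m"
        by (auto simp: under_attack_def)
      then have "real (h m) \<le> real j" "real j + 1 \<le> real (h m) + real (\<tau> m)"
        by linarith+
      moreover have "real j + 1 \<le> real k" using \<open>j < k\<close> by linarith
      ultimately have "x \<in> attack_interval h \<tau> m" "x \<in> {0..real k}"
        using x by (auto simp: attack_interval_def)
      then show "x \<in> denied h \<tau> 0 (real k)" by (auto simp: denied_def)
    qed
    \<comment> \<open>Monotonicity of \<open>measure\<close> requires the larger set to have finite
      measure.\<close>
    have "denied h \<tau> 0 (real k) \<in> sets borel"
      by (auto simp: denied_def attack_interval_def)
    moreover have "bounded (denied h \<tau> 0 (real k))"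
      by (rule bounded_subset[of "{0..real k}"]) (auto simp: denied_def)
    ultimately show "denied h \<tau> 0 (real k) \<in> fmeasurable lborel"
      by (intro fmeasurableI) (auto dest!: emeasure_bounded_finite)
  qed auto
  finally show ?thesis .
qed

text \<open>With \<open>d\<close> instants satisfying \<open>R\<close>, the exponential is
  \<open>a ^ (k - d) * b ^ d\<close>. The logarithmic form is affine in \<open>d\<close>, so that a
  real bound on \<open>d\<close> can be inserted.\<close>

lemma switched_bound:
  fixes W :: "nat \<Rightarrow> real"
  assumes a: "0 < a" and b: "0 < b"
    and up: "\<And>k. R k \<Longrightarrow> W (Suc k) \<le> b * W k"
    and down: "\<And>k. \<not> R k \<Longrightarrow> W (Suc k) \<le> a * W k"
  shows "W k \<le> exp (ln a * k + (ln b - ln a) * card {j. j < k \<and> R j}) * W 0"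
proof (induction k)
  case (Suc k)
  let ?e = "\<lambda>k::nat. ln a * k + (ln b - ln a) * card {j. j < k \<and> R j}"
  show ?case
  proof (cases "R k")
    case True
    then have "{j. j < Suc k \<and> R j} = insert k {j. j < k \<and> R j}"
      by (auto simp: less_Suc_eq)
    then have "card {j. j < Suc k \<and> R j} = Suc (card {j. j < k \<and> R j})"
      by simp
    then have e: "?e (Suc k) = ln b + ?e k"
      by (simp add: algebra_simps)
    have "W (Suc k) \<le> b * W k" using True by (rule up)
    also have "\<dots> \<le> b * (exp (?e k) * W 0)"
      using Suc.IH b by (intro mult_left_mono) auto
    also have "\<dots> = exp (?e (Suc k)) * W 0"
      unfolding e using b by (simp add: exp_add)
    finally show ?thesis .
  next
    case False
    then have "{j. j < Suc k \<and> R j} = {j. j < k \<and> R j}"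
      by (auto simp: less_Suc_eq)
    then have "card {j. j < Suc k \<and> R j} = card {j. j < k \<and> R j}"
      by simp
    then have e: "?e (Suc k) = ln a + ?e k"
      by (simp add: algebra_simps)
    have "W (Suc k) \<le> a * W k" using False by (rule down)
    also have "\<dots> \<le> a * (exp (?e k) * W 0)"
      using Suc.IH a by (intro mult_left_mono) auto
    also have "\<dots> = exp (?e (Suc k)) * W 0"
      unfolding e using a by (simp add: exp_add)
    finally show ?thesis .
  qed
qed simp

text \<open>As \<open>a \<le> b\<close>, the exponent is monotone in the number of denied instants.
  In the duration bound, \<kappa> contributes a constant factor and \<open>1 / T\<close> changes the
  rate.\<close>

lemma dos_switched_bound:
  fixes W :: "nat \<Rightarrow> real" and a b T \<kappa> :: real
  assumes dur: "dos_duration h \<tau> T \<kappa>" and ab: "0 < a" "a \<le> b"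
    and nonneg: "0 \<le> W 0"
    and up: "\<And>k. under_attack h \<tau> k \<Longrightarrow> W (Suc k) \<le> b * W k"
    and down: "\<And>k. \<not> under_attack h \<tau> k \<Longrightarrow> W (Suc k) \<le> a * W k"
  shows "W k \<le> exp ((ln b - ln a) * \<kappa>) * exp (ln a + (ln b - ln a) / T) ^ k * W 0"
proof -
  let ?d = "real (card {j. j < k \<and> under_attack h \<tau> j})"
  have d: "?d \<le> \<kappa> + real k / T"
  proof (cases "k = 0")
    case True
    then show ?thesis using dur by (simp add: dos_duration_def)
  next
    case False
    then have "measure lborel (denied h \<tau> (real 0) (real k)) \<le> \<kappa> + (real k - real 0) / T"
      using dur unfolding dos_duration_def by blast
    then show ?thesis using card_under_attack_le[of k h \<tau>] by simp
  qed
  have "W k \<le> exp (ln a * k + (ln b - ln a) * ?d) * W 0"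
    using ab up down by (intro switched_bound) auto
  also have "\<dots> \<le> exp (ln a * k + (ln b - ln a) * (\<kappa> + k / T)) * W 0"
    using d ab nonneg by (intro mult_right_mono) (auto intro!: mult_left_mono)
  also have "ln a * k + (ln b - ln a) * (\<kappa> + k / T)
      = (ln b - ln a) * \<kappa> + k * (ln a + (ln b - ln a) / T)"
    by (simp add: algebra_simps diff_divide_distrib)
  finally show ?thesis
    by (simp add: exp_add exp_of_nat_mult)
qed

text \<open>The condition on \<open>T\<close> says that the mean logarithmic growth, with weight
  \<open>1 / T\<close> on \<open>ln b\<close> and \<open>1 - 1 / T\<close> on \<open>ln a\<close>,
  is negative.\<close>

lemma dos_switched_rate:
  fixes a b T :: real
  assumes "0 < a" "a < 1" "1 \<le> b" and T: "T > 1 + ln b / (- ln a)"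
  shows "exp (ln a + (ln b - ln a) / T) < 1"
proof -
  have a: "ln a < 0" and b: "0 \<le> ln b"
    using assms by simp_all
  then have "0 \<le> ln b / (- ln a)"
    by (intro divide_nonneg_pos) auto
  then have "1 < T"
    using T by linarith
  have "ln b / (- ln a) < T - 1" using T by simp
  then have "ln b < (T - 1) * (- ln a)"
    using a pos_divide_less_eq[of "- ln a" "ln b" "T - 1"] by (simp only: neg_0_less_iff_less)
  then have "ln b - ln a < T * (- ln a)" by (simp add: algebra_simps)
  then have "(ln b - ln a) / T < - ln a"
    using \<open>1 < T\<close> by (simp add: pos_divide_less_eq mult.commute)
  then show ?thesis by simp
qed

lemma globally_asymptotically_stable_if_exponential:
  fixes S :: "(nat \<Rightarrow> 'a::real_normed_vector) set"
  assumes c: "0 < c" and \<rho>: "0 \<le> \<rho>" "\<rho> < 1"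
    and bound: "\<And>s k. s \<in> S \<Longrightarrow> (norm (s k))\<^sup>2 \<le> c * \<rho> ^ k * (norm (s 0))\<^sup>2"
  shows "globally_asymptotically_stable S"
  unfolding globally_asymptotically_stable_def
proof (intro conjI allI impI ballI)
  fix \<epsilon> :: real assume \<epsilon>: "0 < \<epsilon>"
  show "\<exists>\<delta>>0. \<forall>s\<in>S. norm (s 0) < \<delta> \<longrightarrow> (\<forall>k. norm (s k) < \<epsilon>)"
  proof (intro exI[of _ "\<epsilon> / sqrt c"] conjI ballI impI allI)
    fix s k assume s: "s \<in> S" "norm (s 0) < \<epsilon> / sqrt c"
    have "(norm (s k))\<^sup>2 \<le> c * \<rho> ^ k * (norm (s 0))\<^sup>2" using s by (intro bound)
    also have "\<dots> \<le> c * 1 * (norm (s 0))\<^sup>2"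
      using c \<rho> by (intro mult_right_mono mult_left_mono power_le_one) auto
    also have "\<dots> < c * 1 * (\<epsilon> / sqrt c)\<^sup>2"
      using c s by (intro mult_strict_left_mono power_strict_mono) auto
    also have "\<dots> = \<epsilon>\<^sup>2" using c by (simp add: power_divide)
    finally show "norm (s k) < \<epsilon>" using \<epsilon> by (simp add: power2_less_imp_less)
  qed (use c \<epsilon> in simp)
next
  fix s assume s: "s \<in> S"
  have "(\<lambda>k. c * \<rho> ^ k * (norm (s 0))\<^sup>2) \<longlonglongrightarrow> c * 0 * (norm (s 0))\<^sup>2"
    using \<rho> by (intro tendsto_intros LIMSEQ_power_zero) auto
  then have "(\<lambda>k. c * \<rho> ^ k * (norm (s 0))\<^sup>2) \<longlonglongrightarrow> 0" by simp
  then have "(\<lambda>k. (norm (s k))\<^sup>2) \<longlonglongrightarrow> 0"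
    by (rule Lim_null_comparison[rotated]) (simp add: bound[OF s])
  then have "(\<lambda>k. sqrt ((norm (s k))\<^sup>2)) \<longlonglongrightarrow> sqrt 0"
    by (intro tendsto_intros)
  then show "s \<longlonglongrightarrow> 0"
    by (simp add: tendsto_norm_zero_iff)
qed

section \<open>Stability under attacks\<close>

text \<open>The hypothesis \<open>V y \<le> 2 w\<close> leaves room for the decay by a factor \<open>1 - \<omega>1\<close> that the state may
  have undergone since the sample \<open>y\<close> was taken.\<close>

lemma held_sample_growth:
  fixes A D M P :: "real ^ 'n ^ 'n"
  assumes P: "sym_posdef P"
    and V: "V = (\<lambda>v. v \<bullet> (P *v v))"
    and x: "V x \<le> w" and y: "V y \<le> 2 * w"
  shows "V (A *v x + D *v (y - x) - M *v y)
    \<le> (9 + 18 * (mnorm (transpose M ** P ** M))\<^sup>2 + 2 * (mnorm (transpose A ** P ** A))\<^sup>2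
        + 16 * (mnorm (transpose D ** P ** D))\<^sup>2) / lambda_min P * w"
proof -
  have sym: "transpose P = P"
    using P by (simp add: sym_posdef_def)
  have pos: "0 < lambda_min P"
    using P by (rule sym_posdef_lambda_min_pos)
  have nonneg: "0 \<le> v \<bullet> (P *v v)" for v
    using P by (cases "v = 0") (auto simp: sym_posdef_def intro: less_imp_le)
  define a d b where "a = mnorm (transpose A ** P ** A)"
    and "d = mnorm (transpose D ** P ** D)" and "b = mnorm (transpose M ** P ** M)"
  have abd: "0 \<le> a" "0 \<le> d" "0 \<le> b"
    by (simp_all add: a_def d_def b_def mnorm_nonneg)
  define c where "c = w / lambda_min P"
  have norm_le: "(norm v)\<^sup>2 \<le> s / lambda_min P" if "V v \<le> s" for v s
    using lambda_min_le[OF sym, of v] that pos by (simp add: V field_simps)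
  have nx: "(norm x)\<^sup>2 \<le> c" and ny: "(norm y)\<^sup>2 \<le> 2 * c"
    using norm_le[OF x] norm_le[OF y] by (simp_all add: c_def)
  have c: "0 \<le> c"
    using nx zero_le_power2[of "norm x"] by linarith
  \<comment> \<open>The parallelogram law.\<close>
  have "(norm (y - x))\<^sup>2 + (norm (y + x))\<^sup>2 = 2 * (norm y)\<^sup>2 + 2 * (norm x)\<^sup>2"
    by (simp add: inner_add_left inner_add_right inner_diff_left inner_diff_right inner_commute
        flip: dot_square_norm)
  then have nyx: "(norm (y - x))\<^sup>2 \<le> 6 * c"
    using nx ny zero_le_power2[of "norm (y + x)"] by linarith
  have "V (A *v x) \<le> a * (norm x)\<^sup>2"
    unfolding V a_def by (rule mult_quadform_le)
  also have "\<dots> \<le> a * c"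
    using nx abd by (intro mult_left_mono) auto
  finally have Va: "V (A *v x) \<le> a * c" .
  have "V (D *v (y - x)) \<le> d * (norm (y - x))\<^sup>2"
    unfolding V d_def by (rule mult_quadform_le)
  also have "\<dots> \<le> d * (6 * c)"
    using nyx abd by (intro mult_left_mono) auto
  finally have Vd: "V (D *v (y - x)) \<le> 6 * d * c" by simp
  have "V (M *v (- y)) \<le> b * (norm (- y))\<^sup>2"
    unfolding V b_def by (rule mult_quadform_le)
  also have "\<dots> \<le> b * (2 * c)"
    using ny abd by (intro mult_left_mono) auto
  finally have Vb: "V (M *v (- y)) \<le> 2 * b * c" by simp
  have "A *v x + D *v (y - x) - M *v y = A *v x + D *v (y - x) + M *v (- y)"
    by (simp add: matrix_vector_mult_minus)
  then have "V (A *v x + D *v (y - x) - M *v y)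
      \<le> 3 * (V (A *v x) + V (D *v (y - x)) + V (M *v (- y)))"
    unfolding V using quadform_add3_le[OF sym nonneg] by metis
  also have "\<dots> \<le> (3 * a + 18 * d + 6 * b) * c"
    using Va Vd Vb by (simp add: algebra_simps)
  also have "\<dots> \<le> (9 + 18 * b\<^sup>2 + 2 * a\<^sup>2 + 16 * d\<^sup>2) * c"
  proof (rule mult_right_mono[OF _ c])
    \<comment> \<open>Completing the squares in \<open>a\<close>, \<open>d\<close> and
      \<open>b\<close> leaves the constant 107/16, which is less than 9.\<close>
    have "0 \<le> 2 * (a - 3 / 4)\<^sup>2 + 16 * (d - 9 / 16)\<^sup>2 + 18 * (b - 1 / 6)\<^sup>2" by simp
    then show "3 * a + 18 * d + 6 * b \<le> 9 + 18 * b\<^sup>2 + 2 * a\<^sup>2 + 16 * d\<^sup>2"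
      by (simp add: power2_diff power_divide algebra_simps)
  qed
  finally show ?thesis
    by (simp add: a_def b_def d_def c_def)
qed

theorem mainTheorem1:
  fixes A :: "real ^ 'n ^ 'n" and B :: "real ^ 1 ^ 'n" and C :: "real ^ 'n ^ 1"
    and D :: "real ^ 'q ^ 'n" and E :: "real ^ 'q ^ 'q" and F :: "real ^ 'q ^ 1"
    and G2 :: "real ^ 1 ^ 'q"
    and Ab :: "real ^ ('n + 'q) ^ ('n + 'q)" and Bb :: "real ^ 1 ^ ('n + 'q)"
    and Cb :: "real ^ ('n + 'q) ^ 1" and Dt :: "real ^ ('n + 'q) ^ ('n + 'q)"
    and Q P :: "real ^ ('n + 'q) ^ ('n + 'q)"
    and K :: "real ^ ('n + 'q) ^ 1" and Kx :: "real ^ 'n ^ 1" and Kz :: "real ^ 'q ^ 1"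
    and X :: "real ^ 'q ^ 'n" and Z :: "real ^ 'q ^ 'q" and \<Xi> :: "real ^ 'q ^ ('n + 'q)"
    and h \<tau> :: "nat \<Rightarrow> nat" and T \<kappa> :: real
    and \<alpha>1 \<alpha>2 \<omega>1 \<omega>2 :: real
  assumes stab: "stabilizable A B"
    and E_spec: "simple_on_unit_circle E"
    and rank_cond: "\<And>l. l \<in> spec E \<Longrightarrow>
          rank (block (cmat A - mat l) (cmat B) (cmat C) 0) = CARD('n) + 1"
    and ctrl: "controllable E G2"
    and Ab: "Ab = block A 0 (G2 ** C) E"
    and Bb: "Bb = stack B 0"
    and Cb: "Cb = beside C 0"
    and Dt: "Dt = stack 0 (G2 ** Cb)"
    and Q: "sym_posdef Q"
    and P: "sym_posdef P"
    and riccati: "transpose Ab ** P ** Ab - P + Q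
          - transpose Ab ** P ** Bb ** matrix_inv (mat 1 + transpose Bb ** P ** Bb)
            ** transpose Bb ** P ** Ab = 0"
    and K: "K = matrix_inv (mat 1 + transpose Bb ** P ** Bb) ** transpose Bb ** P ** Ab"
    and K_split: "K = beside Kx Kz"
    and X_eq: "X ** E = (A - B ** Kx) ** X - B ** Kz ** Z + D"
    and Z_eq: "Z ** E = E ** Z + G2 ** (C ** X + F)"
    and reg_eq: "0 = C ** X + F"
    and Xi: "\<Xi> = stack X Z"
    and h_mono: "strict_mono h"
    and freq: "\<exists>\<eta> \<tau>D. dos_frequency h \<eta> \<tau>D"
    and dur: "dos_duration h \<tau> T \<kappa>"
    and \<alpha>1: "\<alpha>1 = 1 + 2 * (mnorm (transpose K ** transpose Bb ** P ** Bb ** K))\<^sup>2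
          + 2 * (mnorm (transpose Ab ** P ** Ab))\<^sup>2"
    and \<alpha>2: "\<alpha>2 = 2 + 4 * (mnorm (transpose K ** transpose Bb ** P ** Bb ** K))\<^sup>2
          + 4 * (mnorm (transpose Dt ** P ** Dt))\<^sup>2"
    and \<omega>1: "\<omega>1 = lambda_min Q / lambda_max P"
    and \<omega>2: "\<omega>2 = (\<alpha>1 + 4 * \<alpha>2) / lambda_min P"
    and T_large: "T > 1 + ln (1 + \<omega>2) / (- ln (1 - \<omega>1))"
  shows "globally_asymptotically_stable
           {\<zeta>t. error_trajectory A B C D E F G2 K \<Xi> (last_update h \<tau>) \<zeta>t}"
proof -
  define V where "V = (\<lambda>v. v \<bullet> (P *v v))"
  define M where "M = Bb ** K"
  define r where "r = last_update h \<tau>"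
  have symP: "transpose P = P" and symQ: "transpose Q = Q"
    using P Q by (auto simp: sym_posdef_def)
  have lP: "0 < lambda_min P" and lQ: "0 < lambda_min Q"
    using P Q by (auto intro: sym_posdef_lambda_min_pos)
  have V_ge: "lambda_min P * (norm v)\<^sup>2 \<le> V v" and V_le: "V v \<le> lambda_max P * (norm v)\<^sup>2" for v
    using lambda_min_le[OF symP] lambda_max_ge[OF symP] by (auto simp: V_def)
  have V_nonneg: "0 \<le> V v" for v
    by (rule order_trans[OF _ V_ge]) (use lP in simp)
  have lyap: "V ((Ab - M) *v v) = V v - v \<bullet> (Q *v v) - (norm (K *v v))\<^sup>2" for v
    unfolding V_def M_def using P riccati K by (rule riccati_closed_loop)

  obtain z where z: "z \<noteq> 0" "norm z \<le> norm (E *v z)"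
    using spec_norm_ge[of E] E_spec by (auto simp: simple_on_unit_circle_def)
  \<comment> \<open>The input matrix has a zero lower block, so feedback cannot alter the component
    \<open>E *v z\<close>, and the failure of \<open>E\<close> to contract carries over to the
    closed loop.\<close>
  have "(Ab - M) *v vstack 0 z = vstack (- (B *v (K *v vstack 0 z))) (E *v z)"
    unfolding M_def Ab Bb block_def matrix_vector_mult_diff_rdistrib
    by (simp add: stack_mult_vec beside_mult_vec vstack_diff flip: matrix_vector_mul_assoc)
  then have "(norm (E *v z))\<^sup>2 \<le> (norm ((Ab - M) *v vstack 0 z))\<^sup>2"
    by (simp add: norm_vstack)
  moreover have "(norm (vstack 0 z :: real ^ ('n + 'q)))\<^sup>2 = (norm z)\<^sup>2"
    by (simp add: norm_vstack)
  ultimately have "norm (vstack 0 z :: real ^ ('n + 'q)) \<le> norm ((Ab - M) *v vstack 0 z)"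
    using z(2) by (smt (verit) norm_ge_zero power2_eq_imp_eq power_mono power2_le_imp_le)
  moreover have "vstack 0 z \<noteq> (0 :: real ^ ('n + 'q))"
    using \<open>(norm (vstack 0 z))\<^sup>2 = (norm z)\<^sup>2\<close> z(1) by auto
  moreover have "((Ab - M) *v v) \<bullet> (P *v ((Ab - M) *v v)) + v \<bullet> (Q *v v) \<le> v \<bullet> (P *v v)" for v
    using lyap[of v] by (simp add: V_def)
  ultimately have "\<omega>1 \<le> 1 / 2"
    unfolding \<omega>1 by (intro decay_rate_le_half[OF P Q]) auto
  have lM: "0 < lambda_max P"
  proof -
    obtain u where "u \<noteq> 0" "V u = lambda_min P * (norm u)\<^sup>2"
      unfolding V_def by (rule lambda_min_attained[OF symP])
    then have "lambda_min P * (norm u)\<^sup>2 \<le> lambda_max P * (norm u)\<^sup>2"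
      using V_le by metis
    then show ?thesis using \<open>u \<noteq> 0\<close> lP by simp
  qed
  then have "0 < \<omega>1" using lQ by (simp add: \<omega>1)

  have decay: "V ((Ab - M) *v v) \<le> (1 - \<omega>1) * V v" for v
  proof -
    have "\<omega>1 * V v \<le> \<omega>1 * (lambda_max P * (norm v)\<^sup>2)"
      using V_le \<open>0 < \<omega>1\<close> by (intro mult_left_mono) auto
    also have "\<dots> = lambda_min Q * (norm v)\<^sup>2"
      using lM by (simp add: \<omega>1)
    also have "\<dots> \<le> v \<bullet> (Q *v v)" by (rule lambda_min_le[OF symQ])
    finally show ?thesis
      using lyap[of v] zero_le_power2[of "norm (K *v v)"]
      unfolding left_diff_distrib mult_1 by linarith
  qed

  \<comment> \<open>The numerator is \<open>\<alpha>1 + 4 * \<alpha>2\<close>, collected by matrix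
    norms.\<close>
  have \<omega>2': "\<omega>2 = (9 + 18 * (mnorm (transpose M ** P ** M))\<^sup>2
      + 2 * (mnorm (transpose Ab ** P ** Ab))\<^sup>2 + 16 * (mnorm (transpose Dt ** P ** Dt))\<^sup>2)
      / lambda_min P"
    by (simp add: \<omega>2 \<alpha>1 \<alpha>2 M_def matrix_transpose_mul matrix_mul_assoc)
  have \<omega>2_nonneg: "0 \<le> \<omega>2"
    unfolding \<omega>2' using lP by simp
  \<comment> \<open>With \<open>w = W k\<close>, the two hypotheses bound the two arguments of the
    maximum defining \<open>W k\<close> below.\<close>
  have growth: "V (Ab *v x + Dt *v (y - x) - M *v y) \<le> (1 + \<omega>2) * w"
    if "V x \<le> w" "(1 - \<omega>1) * V y \<le> w" for x y w
  proof -
    have "1 / 2 * V y \<le> (1 - \<omega>1) * V y"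
      using \<open>\<omega>1 \<le> 1 / 2\<close> V_nonneg by (intro mult_right_mono) auto
    then have "V y \<le> 2 * w" using that by simp
    then have "V (Ab *v x + Dt *v (y - x) - M *v y) \<le> \<omega>2 * w"
      unfolding \<omega>2' using that by (intro held_sample_growth[OF P V_def])
    also have "\<dots> \<le> (1 + \<omega>2) * w"
      using that V_nonneg[of x] by (simp add: algebra_simps)
    finally show ?thesis .
  qed

  define c \<rho> where "c = exp ((ln (1 + \<omega>2) - ln (1 - \<omega>1)) * \<kappa>)"
    and "\<rho> = exp (ln (1 - \<omega>1) + (ln (1 + \<omega>2) - ln (1 - \<omega>1)) / T)"
  have c: "0 < c" and \<rho>: "0 \<le> \<rho>" "\<rho> < 1"
    using dos_switched_rate[OF _ _ _ T_large] \<open>0 < \<omega>1\<close> \<open>\<omega>1 \<le> 1 / 2\<close> \<omega>2_nonneg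
    by (simp_all add: c_def \<rho>_def)

  have "(norm (s k))\<^sup>2 \<le> (c * lambda_max P / lambda_min P) * \<rho> ^ k * (norm (s 0))\<^sup>2"
    if "error_trajectory A B C D E F G2 K \<Xi> r s" for s k
  proof -
    have Dt_mult: "Dt *v v = vstack 0 (G2 *v (Cb *v v))" for v
      by (simp add: Dt stack_mult_vec flip: matrix_vector_mul_assoc)
    have "s (Suc k) = (Ab - M) *v s k - M *v (s (r k) - s k)
        + vstack 0 (G2 *v (Cb *v (s (r k) - s k)))" for k
      using that unfolding error_trajectory_iff Ab Bb Cb M_def by blast
    then have step: "s (Suc k) = Ab *v s k + Dt *v (s (r k) - s k) - M *v s (r k)" for k
      by (simp add: Dt_mult matrix_vector_mult_diff_rdistrib matrix_vector_mult_diff_distrib[of M])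
    define W where "W k = max (V (s k)) ((1 - \<omega>1) * V (s (r (k - 1))))" for k
    \<comment> \<open>Here \<open>0 - 1 = 0\<close> and \<open>r 0 = 0\<close>, so both arguments of
      the maximum involve \<open>s 0\<close>, and the first dominates.\<close>
    have W0: "W 0 = V (s 0)"
      using mult_nonneg_nonneg[OF less_imp_le[OF \<open>0 < \<omega>1\<close>] V_nonneg[of "s 0"]]
      by (simp add: W_def r_def last_update_0 left_diff_distrib)
    have "W k \<le> c * \<rho> ^ k * W 0"
      unfolding c_def \<rho>_def
    proof (rule dos_switched_bound[OF dur])
      show "0 < 1 - \<omega>1" "1 - \<omega>1 \<le> 1 + \<omega>2"
        using \<open>0 < \<omega>1\<close> \<open>\<omega>1 \<le> 1 / 2\<close> \<omega>2_nonneg by simp_all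
      show "0 \<le> W 0"
        by (simp add: W0 V_nonneg)
    next
      fix k assume "under_attack h \<tau> k"
      then have "r k = r (k - 1)" by (simp add: r_def last_update_denied)
      then have le: "V (s k) \<le> W k" "(1 - \<omega>1) * V (s (r k)) \<le> W k"
        by (simp_all add: W_def)
      \<comment> \<open>At a denied instant the held sample is unchanged, so the second argument of
        \<open>W (Suc k)\<close> is at most \<open>W k\<close>; a growth factor of at least one
        covers it.\<close>
      moreover have "W k \<le> (1 + \<omega>2) * W k"
        using \<omega>2_nonneg le V_nonneg[of "s k"] by (simp add: algebra_simps)
      moreover have "V (s (Suc k)) \<le> (1 + \<omega>2) * W k"
        unfolding step using le by (rule growth)
      ultimately show "W (Suc k) \<le> (1 + \<omega>2) * W k"
        unfolding W_def[of "Suc k"] by simp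
    next
      fix k assume "\<not> under_attack h \<tau> k"
      then have r: "r k = k" by (simp add: r_def last_update_allowed)
      have "V (s (Suc k)) \<le> (1 - \<omega>1) * V (s k)"
        using decay[of "s k"] by (simp add: step r matrix_vector_mult_diff_rdistrib)
      \<comment> \<open>As \<open>r k = k\<close>, the second argument of the maximum is exactly
        \<open>(1 - \<omega>1) * V (s k)\<close>.\<close>
      then have "W (Suc k) \<le> (1 - \<omega>1) * V (s k)"
        by (simp add: W_def r)
      also have "\<dots> \<le> (1 - \<omega>1) * W k"
        using \<open>\<omega>1 \<le> 1 / 2\<close> by (intro mult_left_mono) (auto simp: W_def)
      finally show "W (Suc k) \<le> (1 - \<omega>1) * W k" .
    qed
    then have "lambda_min P * (norm (s k))\<^sup>2 \<le> c * \<rho> ^ k * V (s 0)"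
      using V_ge[of "s k"] unfolding W0 by (simp add: W_def)
    also have "\<dots> \<le> c * \<rho> ^ k * (lambda_max P * (norm (s 0))\<^sup>2)"
      using c \<rho> V_le by (intro mult_left_mono) auto
    finally show ?thesis
      using lP by (simp add: field_simps)
  qed
  then show ?thesis
    unfolding r_def using c \<rho> lP lM
    by (intro globally_asymptotically_stable_if_exponential
        [of "c * lambda_max P / lambda_min P" \<rho>]) auto
qed

end
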